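(* Let $$f(x)=\tfrac12x^\top Qx+c^\top x+\beta,\qquad Q=Q^\top\in\mathbb{R}^{n\times n},\ c\in\mathbb{R}^n,\ \beta\in\mathbb{R}.$$ Then $d^\star(f;X)=n_+(Q)$. If $Q=Q_+-Q_-$ is the positive–negative spectral decomposition, the pair $$g(x)=\tfrac12x^\top Q_+x,\qquad h(x)=\tfrac12x^\top Q_-x-c^\top x-\beta$$ attains the minimum, i.e. $(g,h)\in\mathcal{D}^2(f;X)$ and $d_X(g)=d^\star(f;X)$.
   Context: $X\subset\mathbb{R}^n$ is compact and full dimensional (its affine hull is $\mathbb{R}^n$) and $\widehat X=\operatorname{conv}X$. $\mathcal{D}^2(f;X)$ is the set of pairs $(g,h)$ of functions that are $C^2$ on a neighborhood of $\widehat X$, satisfy $f=g-h$ there, and are convex on $\widehat X$ (equivalently, have positive semidefinite Hessians at every point of $\widehat X$). For a $C^2$ convex $g$: $V_X(g)=\operatorname{span}\bigl(\bigcup_{z\in\widehat X}\operatorname{range}\nabla^2g(z)\bigr)$, $d_X(g)=\dim V_X(g)$, and $d^\star(f;X)=\min_{(g,h)\in\mathcal{D}^2(f;X)}d_X(g)$. $n_+(Q)$ is the number of positive eigenvalues of $Q$ counted with multiplicity. In the positive–negative spectral decomposition, $Q_+$ and $Q_-$ are the positive semidefinite matrices obtained from a spectral decomposition of $Q$ by replacing each eigenvalue $\lambda$ by $\max\{\lambda,0\}$ and $\max\{-\lambda,0\}$, respectively. *)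

theory Defs
  imports
    "HOL-Analysis.Analysis"
    "HOL-Computational_Algebra.Computational_Algebra"
begin

(* grad and hessian carry information only where the derivatives in question exist;
   they are used below only on open sets on which the function is C2. *)

definition grad :: "(real^'n \<Rightarrow> real) \<Rightarrow> real^'n \<Rightarrow> real^'n" where
  "grad f x = (THE D. GDERIV f x :> D)"

definition hessian :: "(real^'n \<Rightarrow> real) \<Rightarrow> real^'n \<Rightarrow> real^'n^'n" where
  "hessian f x = jacobian (grad f) (at x)"

definition C2_on :: "(real^'n) set \<Rightarrow> (real^'n \<Rightarrow> real) \<Rightarrow> bool" where
  "C2_on U f \<longleftrightarrow> open U
     \<and> (\<forall>x\<in>U. f differentiable at x)
     \<and> (\<forall>x\<in>U. grad f differentiable at x)
     \<and> continuous_on U (hessian f)"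

(* Functions on a neighborhood U of the convex hull are represented by total functions;
   their values outside U play no role. *)

definition D2 :: "(real^'n \<Rightarrow> real) \<Rightarrow> (real^'n) set
    \<Rightarrow> ((real^'n \<Rightarrow> real) \<times> (real^'n \<Rightarrow> real)) set" where
  "D2 f X = {(g, h).
     (\<exists>U. open U \<and> convex hull X \<subseteq> U \<and> C2_on U g \<and> C2_on U h \<and> (\<forall>x\<in>U. f x = g x - h x))
     \<and> convex_on (convex hull X) g \<and> convex_on (convex hull X) h}"

definition V_X :: "(real^'n) set \<Rightarrow> (real^'n \<Rightarrow> real) \<Rightarrow> (real^'n) set" where
  "V_X X g = span (\<Union>z\<in>convex hull X. range (\<lambda>v. hessian g z *v v))"

definition d_X :: "(real^'n) set \<Rightarrow> (real^'n \<Rightarrow> real) \<Rightarrow> nat" where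
  "d_X X g = dim (V_X X g)"

(* An infimum of natural numbers: it is attained, hence a minimum, as soon as D2 f X is nonempty. *)

definition d_star :: "(real^'n \<Rightarrow> real) \<Rightarrow> (real^'n) set \<Rightarrow> nat" where
  "d_star f X = (INF (g, h)\<in>D2 f X. d_X X g)"

definition charpoly :: "real^'n^'n \<Rightarrow> real poly" where
  "charpoly Q = det (\<chi> i j. (if i = j then [:0, 1:] else 0) - [:Q $ i $ j:])"

(* The multiset proots lists each root as often as its multiplicity. *)

definition n_plus :: "real^'n^'n \<Rightarrow> nat" where
  "n_plus Q = size {# l \<in># proots (charpoly Q). l > 0 #}"

definition diag_matrix :: "('n \<Rightarrow> real) \<Rightarrow> real^'n^'n" where
  "diag_matrix d = (\<chi> i j. if i = j then d i else 0)"

definition pos_neg_decomp :: "real^'n^'n \<Rightarrow> real^'n^'n \<Rightarrow> real^'n^'n \<Rightarrow> bool" where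
  "pos_neg_decomp Q Qp Qm \<longleftrightarrow> (\<exists>P d. orthogonal_matrix P
     \<and> Q = P ** diag_matrix d ** transpose P
     \<and> Qp = P ** diag_matrix (\<lambda>i. max (d i) 0) ** transpose P
     \<and> Qm = P ** diag_matrix (\<lambda>i. max (- d i) 0) ** transpose P)"

end

theory Submission
  imports Defs
begin

text \<open>The interior of the convex hull of \<open>X\<close> is nonempty. At an interior point the
  Hessians \<open>G\<close> and \<open>H\<close> of a convex pair satisfy \<open>Q = G - H\<close> with \<open>H\<close> positive semidefinite, so
  \<open>G\<close> dominates \<open>Q\<close> as a quadratic form. Hence \<open>G\<close> is injective on the span of the eigenvectors
  of \<open>Q\<close> with positive eigenvalue, and its rank is at least \<open>n_plus Q\<close>. For the spectral pair the
  Hessian of \<open>g\<close> is constantly the positive part of \<open>Q\<close>, whose rank is exactly \<open>n_plus Q\<close>.\<close>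

text \<open>The infix \<open>$\<close> of formal power series would compete with the component
  notation for vectors.\<close>

no_notation fps_nth (infixl \<open>$\<close> 75)

section \<open>The spectral theorem\<close>

lemma dot_matrix_vector_symmetric:
  fixes Q :: "real^'n^'n"
  assumes "transpose Q = Q"
  shows "x \<bullet> (Q *v y) = (Q *v x) \<bullet> y"
  by (metis assms dot_lmul_matrix vector_transpose_matrix)

text \<open>Near \<open>t = 0\<close> the linear term dominates, so a nonzero \<open>b\<close> would
  make the expression negative on one side of 0. This is the first-order condition at the maximum of
  the Rayleigh quotient.\<close>

lemma nonneg_linear_quadratic_imp_zero:
  fixes a b :: real
  assumes "\<And>t. 0 \<le> 2 * t * b + t\<^sup>2 * a"
  shows "b = 0"
proof (rule ccontr)
  assume b: "b \<noteq> 0"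
  \<comment> \<open>At \<open>t = - b / k\<close> the expression times \<open>k\<^sup>2\<close>
    equals \<open>b\<^sup>2 * (a - 2 * k)\<close>; the summand 1 keeps \<open>k\<close> positive
    when \<open>a = 0\<close>.\<close>
  define k where "k = \<bar>a\<bar> + 1"
  have k: "k > 0" "a < k" by (auto simp: k_def)
  have "0 \<le> 2 * (- b / k) * b + (- b / k)\<^sup>2 * a" by (rule assms)
  then have "0 \<le> (2 * (- b / k) * b + (- b / k)\<^sup>2 * a) * k\<^sup>2" by simp
  also have "\<dots> = b\<^sup>2 * (a - 2 * k)"
    using k by (simp add: field_simps power2_eq_square)
  also have "\<dots> < 0"
    using b k by (simp add: mult_less_0_iff)
  finally show False by simp
qed

text \<open>The Rayleigh quotient on the unit sphere of the subspace is maximal at an eigenvector: the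
  first variation in the direction of the residual \<open>l x - Q x\<close> is the squared norm of the residual.\<close>

lemma symmetric_eigenvector_in_invariant_subspace:
  fixes Q :: "real^'n^'n"
  assumes Q: "transpose Q = Q" and S: "subspace S" and inv: "\<And>x. x \<in> S \<Longrightarrow> Q *v x \<in> S"
    and ne: "S \<noteq> {0}"
  obtains x l where "x \<in> S" "norm x = 1" "Q *v x = l *\<^sub>R x"
proof -
  define K where "K = S \<inter> sphere 0 1"
  have "compact K"
    unfolding K_def using closed_subspace[OF S] by (simp add: closed_Int_compact)
  moreover obtain y where "y \<in> S" "y \<noteq> 0"
    using ne subspace_0[OF S] by blast
  then have "y /\<^sub>R norm y \<in> K"
    unfolding K_def using subspace_scale[OF S] by simp
  then have "K \<noteq> {}" by blast
  moreover have "continuous_on K (\<lambda>x. x \<bullet> (Q *v x))"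
    by (intro continuous_intros linear_continuous_on linear_conv_bounded_linear[THEN iffD1])
       auto
  ultimately obtain x where x: "x \<in> K" and max: "\<And>y. y \<in> K \<Longrightarrow> y \<bullet> (Q *v y) \<le> x \<bullet> (Q *v x)"
    using continuous_attains_sup by metis
  define l where "l = x \<bullet> (Q *v x)"
  define r where "r = l *\<^sub>R x - Q *v x"
  have xS: "x \<in> S" and nx: "norm x = 1" using x by (auto simp: K_def)
  have xx: "x \<bullet> x = 1" using nx by (simp add: norm_eq_1)
  \<comment> \<open>Both sides are homogeneous of degree 2, so the maximality of \<open>x\<close> on
    the unit sphere carries over to all of \<open>S\<close>.\<close>
  have le: "y \<bullet> (Q *v y) \<le> l * (y \<bullet> y)" if "y \<in> S" for y
  proof (cases "y = 0")
    case False
    have "y /\<^sub>R norm y \<in> K"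
      unfolding K_def using subspace_scale[OF S that] False by simp
    from max[OF this] have "y \<bullet> (Q *v y) / (norm y)\<^sup>2 \<le> l"
      by (simp add: l_def matrix_vector_mult_scaleR power2_eq_square field_simps)
    then show ?thesis using False by (simp add: field_simps power2_norm_eq_inner)
  qed simp
  \<comment> \<open>Invariance of \<open>S\<close> makes the residual an admissible direction of
    variation.\<close>
  have rS: "r \<in> S"
    unfolding r_def using inv xS S by (simp add: subspace_diff subspace_scale)
  have "r \<bullet> r = 0"
  proof (rule nonneg_linear_quadratic_imp_zero)
    fix t
    have "x + t *\<^sub>R r \<in> S" using xS rS S by (simp add: subspace_add subspace_scale)
    from le[OF this]
    have "0 \<le> 2 * t * (l * (x \<bullet> r) - (Q *v x) \<bullet> r) + t\<^sup>2 * (l * (r \<bullet> r) - r \<bullet> (Q *v r))"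
      unfolding matrix_vector_right_distrib matrix_vector_mult_scaleR inner_add_left inner_add_right
        inner_scaleR_left inner_scaleR_right inner_commute[of r x] xx l_def[symmetric]
        dot_matrix_vector_symmetric[OF Q, of x r] inner_commute[of r "Q *v x"]
      by (simp add: algebra_simps power2_eq_square)
    also have "l * (x \<bullet> r) - (Q *v x) \<bullet> r = r \<bullet> r"
      using inner_diff_left[of "l *\<^sub>R x" "Q *v x" r] by (simp flip: r_def)
    finally show "0 \<le> 2 * t * (r \<bullet> r) + t\<^sup>2 * (l * (r \<bullet> r) - r \<bullet> (Q *v r))" .
  qed
  then have "Q *v x = l *\<^sub>R x" by (simp add: r_def)
  with xS nx show thesis by (rule that)
qed

text \<open>Induction on the dimension: split off one unit eigenvector \<open>x\<close>. By symmetry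
  of \<open>Q\<close>, the complement of \<open>x\<close> in \<open>S\<close> is again invariant.
  General invariant subspaces appear in the statement because the induction passes to this
  complement.\<close>

lemma symmetric_eigenbasis_of_invariant_subspace:
  fixes Q :: "real^'n^'n"
  assumes Q: "transpose Q = Q" and S: "subspace S" and inv: "\<And>x. x \<in> S \<Longrightarrow> Q *v x \<in> S"
  shows "\<exists>B. B \<subseteq> S \<and> finite B \<and> card B = dim S \<and> pairwise orthogonal B
    \<and> (\<forall>b\<in>B. norm b = 1 \<and> (\<exists>l. Q *v b = l *\<^sub>R b))"
  using S inv
proof (induction "dim S" arbitrary: S rule: less_induct)
  case less
  show ?case
  proof (cases "S = {0}")
    case True
    then show ?thesis by (intro exI[of _ "{}"]) auto
  next
    case False
    obtain x l where x: "x \<in> S" "norm x = 1" "Q *v x = l *\<^sub>R x"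
      using symmetric_eigenvector_in_invariant_subspace[OF Q less.prems False] by blast
    have xx: "x \<bullet> x = 1" using x(2) by (simp add: norm_eq_1)
    define T where "T = {y \<in> S. orthogonal x y}"
    have T: "subspace T"
    proof -
      have "T = S \<inter> {y. orthogonal x y}" by (auto simp: T_def)
      then show ?thesis using less.prems(1) subspace_orthogonal_to_vector
        by (metis subspace_inter)
    qed
    have invT: "Q *v y \<in> T" if "y \<in> T" for y
      using that less.prems(2) dot_matrix_vector_symmetric[OF Q, of x y] x(3)
      by (auto simp: T_def orthogonal_def)
    have xT: "x \<notin> T" using xx by (auto simp: T_def orthogonal_def)
    have "insert x T \<subseteq> S" using x by (auto simp: T_def)
    \<comment> \<open>Subtracting from \<open>y\<close> its projection onto \<open>x\<close> leaves
      a vector of \<open>T\<close>; hence the dimension drops by exactly one.\<close>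
    have "S \<subseteq> span (insert x T)"
    proof
      fix y assume y: "y \<in> S"
      have "y - (x \<bullet> y) *\<^sub>R x \<in> T"
        using y x less.prems(1) xx
        by (auto simp: T_def orthogonal_def inner_diff_right subspace_diff subspace_scale)
      then have "(x \<bullet> y) *\<^sub>R x + (y - (x \<bullet> y) *\<^sub>R x) \<in> span (insert x T)"
        by (intro span_add span_scale span_base) auto
      then show "y \<in> span (insert x T)" by simp
    qed
    then have "dim S = dim (insert x T)"
      using \<open>insert x T \<subseteq> S\<close> by (metis dim_span dim_subset dual_order.antisym)
    then have dimS: "dim S = Suc (dim T)"
      using xT T by (simp add: dim_insert span_eq_iff[THEN iffD2])
    then obtain B where B: "B \<subseteq> T" "finite B" "card B = dim T" "pairwise orthogonal B"
      "\<forall>b\<in>B. norm b = 1 \<and> (\<exists>l. Q *v b = l *\<^sub>R b)"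
      using less.hyps[OF _ T invT] by auto
    have "x \<notin> B" using B xT by blast
    then show ?thesis
      using B x dimS \<open>insert x T \<subseteq> S\<close>
      by (intro exI[of _ "insert x B"]) (auto simp: pairwise_insert T_def orthogonal_commute)
  qed
qed

lemma matrix_mul_diag_matrix_column:
  "column i (P ** diag_matrix d) = d i *\<^sub>R column i P"
  by (simp add: vec_eq_iff column_def matrix_matrix_mult_def diag_matrix_def if_distrib mult.commute
      cong: if_cong)

lemma symmetric_orthogonal_diagonalization:
  fixes Q :: "real^'n^'n"
  assumes Q: "transpose Q = Q"
  obtains P d where "orthogonal_matrix P" "Q = P ** diag_matrix d ** transpose P"
proof -
  obtain B :: "(real^'n) set" where B: "finite B" "card B = CARD('n)" "pairwise orthogonal B"
    "\<forall>b\<in>B. norm b = 1 \<and> (\<exists>l. Q *v b = l *\<^sub>R b)"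
    using symmetric_eigenbasis_of_invariant_subspace[OF Q subspace_UNIV] by auto
  \<comment> \<open>The basis has as many elements as the index type, so it can be numbered by that
    type and written as the columns of a square matrix.\<close>
  obtain p where p: "bij_betw p (UNIV :: 'n set) B"
    using finite_same_card_bij[OF finite_class.finite_UNIV B(1)] B(2) by auto
  then have pB: "p i \<in> B" for i by (auto simp: bij_betw_def)
  then have "\<forall>i. \<exists>l. Q *v p i = l *\<^sub>R p i" using B(4) by blast
  from choice[OF this] obtain d where d: "\<And>i. Q *v p i = d i *\<^sub>R p i" by blast
  define P :: "real^'n^'n" where "P = (\<chi> i j. p j $ i)"
  have col: "column i P = p i" for i by (simp add: column_def P_def vec_eq_iff)
  have P: "orthogonal_matrix P"
    unfolding orthogonal_matrix_orthonormal_columns col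
  proof (intro conjI allI impI)
    show "norm (p i) = 1" for i using B(4) pB by blast
    show "orthogonal (p i) (p j)" if "i \<noteq> j" for i j
      using pairwiseD[OF B(3) pB pB] bij_betw_imp_inj_on[OF p] that by (auto dest: injD)
  qed
  have "column i (Q ** P) = Q *v column i P" for i
    by (simp add: vec_eq_iff column_def matrix_matrix_mult_def matrix_vector_mult_def)
  then have "column i (Q ** P) = column i (P ** diag_matrix d)" for i
    by (simp add: col d matrix_mul_diag_matrix_column)
  then have QP: "Q ** P = P ** diag_matrix d"
    by (simp add: vec_eq_iff column_def)
  have "P ** diag_matrix d ** transpose P = Q ** (P ** transpose P)"
    unfolding QP[symmetric] by (simp add: matrix_mul_assoc)
  also have "\<dots> = Q" using P by (simp add: orthogonal_matrix_def)
  finally show thesis using that P by metis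
qed

section \<open>The characteristic polynomial\<close>

text \<open>Moves real matrices into the matrix ring over \<open>real poly\<close>, where the
  determinant in \<open>charpoly\<close> is taken and is multiplicative.\<close>

definition const_poly_matrix :: "real^'n^'m \<Rightarrow> real poly^'n^'m" where
  "const_poly_matrix A = (\<chi> i j. [:A $ i $ j:])"

lemma const_poly_matrix_mul:
  "const_poly_matrix (A ** B) = const_poly_matrix A ** const_poly_matrix B"
proof -
  have "[:\<Sum>k\<in>UNIV. A $ i $ k * B $ k $ j:] = (\<Sum>k\<in>UNIV. [:A $ i $ k:] * [:B $ k $ j:])" for i j
    by (intro poly_eqI) (simp add: coeff_sum coeff_pCons mult.commute split: nat.split)
  then show ?thesis
    by (simp add: const_poly_matrix_def matrix_matrix_mult_def vec_eq_iff)
qed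

lemma charpoly_eq_det_const_poly_matrix:
  "charpoly Q = det (mat [:0, 1:] - const_poly_matrix Q)"
  unfolding charpoly_def
  by (rule arg_cong[of _ _ det]) (simp add: vec_eq_iff mat_def const_poly_matrix_def)

text \<open>Conjugating the matrix under the determinant by \<open>P\<close> fixes its scalar part
  and turns \<open>A\<close> into its conjugate. The outer factors contribute the determinant of the
  identity.\<close>

lemma charpoly_orthogonal_conjugate:
  fixes P :: "real^'n^'n"
  assumes "orthogonal_matrix P"
  shows "charpoly (P ** A ** transpose P) = charpoly A"
proof -
  let ?c = "const_poly_matrix"
  have diff_l: "(M - N) ** L = M ** L - N ** L" and diff_r: "L ** (M - N) = L ** M - L ** N"
    for M N L :: "real poly^'n^'n"
    by (simp_all add: matrix_matrix_mult_def vec_eq_iff algebra_simps sum_subtractf)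
  have one: "?c P ** ?c (transpose P) = mat 1"
    using assms
    by (simp flip: const_poly_matrix_mul add: orthogonal_matrix_def)
       (simp add: const_poly_matrix_def mat_def vec_eq_iff one_pCons)
  have "?c P ** mat [:0, 1:] ** ?c (transpose P) = mat [:0, 1:] ** (?c P ** ?c (transpose P))"
    by (simp add: vec_eq_iff matrix_matrix_mult_def mat_def if_distrib if_distribR sum_distrib_left
        algebra_simps cong: if_cong)
  then have "?c P ** (mat [:0, 1:] - ?c A) ** ?c (transpose P)
      = mat [:0, 1:] - ?c (P ** A ** transpose P)"
    by (simp add: one const_poly_matrix_mul diff_l diff_r)
  then have "charpoly (P ** A ** transpose P) = det (?c P ** (mat [:0, 1:] - ?c A) ** ?c (transpose P))"
    by (simp add: charpoly_eq_det_const_poly_matrix)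
  also have "\<dots> = charpoly A * det (?c P ** ?c (transpose P))"
    by (simp only: charpoly_eq_det_const_poly_matrix det_mul mult_ac)
  finally show ?thesis by (simp add: one)
qed

lemma charpoly_diag_matrix: "charpoly (diag_matrix d) = (\<Prod>i\<in>UNIV. [:- d i, 1:])"
  unfolding charpoly_def
  by (subst det_diagonal) (auto simp: diag_matrix_def)

text \<open>The roots of the characteristic polynomial, with multiplicity, are the diagonal entries.
  This connects the multiset count in \<open>n_plus\<close> with the index sets on which the linear
  algebra works.\<close>

lemma n_plus_orthogonal_diagonalization:
  fixes P :: "real^'n^'n"
  assumes "orthogonal_matrix P"
  shows "n_plus (P ** diag_matrix d ** transpose P) = card {i. d i > 0}"
proof -
  have "proots (charpoly (P ** diag_matrix d ** transpose P)) = (\<Sum>i\<in>UNIV. {#d i#})"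
    by (simp add: charpoly_orthogonal_conjugate[OF assms] charpoly_diag_matrix proots_prod)
  \<comment> \<open>Generalized from \<open>UNIV\<close> to a finite set for the induction.\<close>
  moreover have "size {#l \<in># (\<Sum>i\<in>A. {#d i#}). l > 0#} = card {i\<in>A. d i > 0}" if "finite A" for A
    using that
  proof (induction A)
    case (insert a A)
    then have "{i \<in> insert a A. 0 < d i} = (if 0 < d a then insert a {i\<in>A. 0 < d i} else {i\<in>A. 0 < d i})"
      by auto
    with insert show ?case by simp
  qed simp
  ultimately show ?thesis by (simp add: n_plus_def)
qed

section \<open>Spans of eigenvectors\<close>

text \<open>Instances with the same \<open>P\<close> but different \<open>d\<close> yield
  \<open>Q\<close> and its positive and negative parts with common eigenvectors.\<close>

locale orthogonal_diagonalization =
  fixes P :: "real^'n^'n" and d :: "'n \<Rightarrow> real"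
  assumes orthogonal: "orthogonal_matrix P"
begin

definition A :: "real^'n^'n" where
  "A = P ** diag_matrix d ** transpose P"

definition eigvec :: "'n \<Rightarrow> real^'n" where
  "eigvec i = column i P"

lemma inner_eigvec: "eigvec i \<bullet> eigvec j = (if i = j then 1 else 0)"
  using orthogonal
  by (auto simp: orthogonal_matrix_orthonormal_columns eigvec_def orthogonal_def norm_eq_1)

lemma mult_vec_eq_sum: "A *v v = (\<Sum>i\<in>UNIV. (d i * (eigvec i \<bullet> v)) *\<^sub>R eigvec i)"
proof -
  have "(diag_matrix d *v (transpose P *v v)) $ i = d i * (eigvec i \<bullet> v)" for i
    by (simp add: diag_matrix_def matrix_vector_mult_def transpose_def eigvec_def column_def
        inner_vec_def if_distrib if_distribR cong: if_cong)
  then show ?thesis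
    unfolding A_def
    by (simp add: matrix_vector_mul_assoc[symmetric] matrix_mult_sum[of P] eigvec_def scalar_mult_eq_scaleR)
qed

lemma inner_mult_vec: "v \<bullet> (A *v v) = (\<Sum>i\<in>UNIV. d i * (eigvec i \<bullet> v)\<^sup>2)"
  by (simp add: mult_vec_eq_sum inner_sum_right power2_eq_square inner_commute mult_ac)

lemma mult_eigvec: "A *v eigvec i = d i *\<^sub>R eigvec i"
  by (simp add: mult_vec_eq_sum inner_eigvec if_distrib if_distribR cong: if_cong)

lemma transpose_eq: "transpose A = A"
proof -
  have "transpose (diag_matrix d) = diag_matrix d"
    by (auto simp: transpose_def diag_matrix_def vec_eq_iff)
  then show ?thesis by (simp add: A_def matrix_transpose_mul matrix_mul_assoc)
qed

lemma eigvec_expansion: "v = (\<Sum>i\<in>UNIV. (eigvec i \<bullet> v) *\<^sub>R eigvec i)"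
proof -
  have "v = P *v (transpose P *v v)"
    using orthogonal unfolding matrix_vector_mul_assoc by (simp add: orthogonal_matrix_def)
  moreover have "(transpose P *v v) $ i = eigvec i \<bullet> v" for i
    by (simp add: matrix_vector_mult_def transpose_def eigvec_def column_def inner_vec_def)
  ultimately show ?thesis
    by (simp add: matrix_mult_sum[of P] eigvec_def scalar_mult_eq_scaleR)
qed

lemma dim_eigvec: "dim (eigvec ` I) = card I"
proof -
  have "pairwise orthogonal (eigvec ` I)"
    by (auto simp: pairwise_def orthogonal_def inner_eigvec)
  moreover have "0 \<notin> eigvec ` I"
    using inner_eigvec by (metis imageE inner_zero_left zero_neq_one)
  ultimately have "independent (eigvec ` I)" by (rule pairwise_orthogonal_independent)
  moreover have "inj_on eigvec I"
    using inner_eigvec by (metis inj_onI zero_neq_one)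
  ultimately show ?thesis by (simp add: dim_eq_card_independent card_image)
qed

text \<open>Terms with eigenvalue 0 vanish from the expansion of \<open>A *v v\<close>; any other
  eigenvector is the image of itself divided by its eigenvalue.\<close>

lemma span_range_mult_vec: "span (range ((*v) A)) = span (eigvec ` {i. d i \<noteq> 0})"
proof (rule span_eq[THEN iffD2], intro conjI subsetI)
  fix y assume "y \<in> range ((*v) A)"
  then obtain v where y: "y = A *v v" by blast
  show "y \<in> span (eigvec ` {i. d i \<noteq> 0})"
    unfolding y mult_vec_eq_sum
  proof (rule span_sum)
    fix i show "(d i * (eigvec i \<bullet> v)) *\<^sub>R eigvec i \<in> span (eigvec ` {i. d i \<noteq> 0})"
      by (cases "d i = 0") (auto intro: span_scale span_base span_zero)
  qed
next
  fix y assume "y \<in> eigvec ` {i. d i \<noteq> 0}"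
  then obtain i where i: "d i \<noteq> 0" "y = eigvec i" by blast
  then have "y = A *v (eigvec i /\<^sub>R d i)"
    by (simp add: matrix_vector_mult_scaleR mult_eigvec)
  then show "y \<in> span (range ((*v) A))" by (metis rangeI span_base)
qed

lemma dim_range_mult_vec: "dim (range ((*v) A)) = card {i. d i \<noteq> 0}"
  by (metis dim_eigvec dim_span span_range_mult_vec)

text \<open>Such a \<open>v\<close> is orthogonal to all other eigenvectors, so its quadratic form
  is a sum of nonnegative terms. If the sum is at most 0, every coefficient of \<open>v\<close>
  vanishes.\<close>

lemma positive_definite_on_span:
  assumes v: "v \<in> span (eigvec ` {i. d i > 0})" and le: "v \<bullet> (A *v v) \<le> 0"
  shows "v = 0"
proof -
  have zero: "eigvec i \<bullet> v = 0" if "\<not> d i > 0" for i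
  proof -
    have "orthogonal (eigvec i) v"
      using that by (intro orthogonal_to_span[OF v]) (auto simp: orthogonal_def inner_eigvec)
    then show ?thesis by (simp add: orthogonal_def)
  qed
  then have nonneg: "0 \<le> d i * (eigvec i \<bullet> v)\<^sup>2" for i
    by (cases "d i > 0") auto
  then have "(\<Sum>i\<in>UNIV. d i * (eigvec i \<bullet> v)\<^sup>2) = 0"
    using le by (simp add: inner_mult_vec sum_nonneg antisym)
  then have "d i * (eigvec i \<bullet> v)\<^sup>2 = 0" for i
    using nonneg by (simp add: sum_nonneg_eq_0_iff)
  then have "eigvec i \<bullet> v = 0" for i
    using zero[of i] by (cases "d i > 0") (auto simp: less_le)
  then show ?thesis using eigvec_expansion[of v] by simp
qed

text \<open>A kernel vector of \<open>H\<close> has a nonpositive value under the form of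
  \<open>A\<close>, so the kernel meets the positive eigenspace only in 0.\<close>

lemma card_positive_le_dim_range:
  fixes H :: "real^'n^'n"
  assumes "\<And>v. v \<bullet> (A *v v) \<le> v \<bullet> (H *v v)"
  shows "card {i. d i > 0} \<le> dim (range ((*v) H))"
proof -
  let ?W = "eigvec ` {i. d i > 0}"
  have "v = 0" if "v \<in> span ?W" "H *v v = 0" for v
    using positive_definite_on_span[OF that(1)] assms[of v] that(2) by simp
  then have "inj_on ((*v) H) (span ?W)"
    by (simp add: linear_injective_on_subspace_0)
  then have "dim ((*v) H ` ?W) = dim ?W" by (intro dim_image_eq) auto
  moreover have "dim ((*v) H ` ?W) \<le> dim (range ((*v) H))" by (intro dim_subset) auto
  ultimately show ?thesis by (simp add: dim_eigvec)
qed

end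

section \<open>Gradients and Hessians\<close>

text \<open>The definite description in \<open>grad\<close> requires uniqueness, which comes from
  that of the Frechet derivative.\<close>

lemma grad_eqI:
  assumes "GDERIV f x :> D"
  shows "grad f x = D"
  unfolding grad_def
proof (rule the_equality[of "\<lambda>D. GDERIV f x :> D"])
  show "GDERIV f x :> D" by fact
  fix D' assume "GDERIV f x :> D'"
  with assms have "(\<lambda>h. h \<bullet> D') = (\<lambda>h. h \<bullet> D)"
    unfolding gderiv_def by (rule has_derivative_unique[rotated])
  then show "D' = D" by (metis vector_eq_rdot inner_commute)
qed

text \<open>Riesz representation: a linear functional is the inner product with its adjoint
  evaluated at 1.\<close>

lemma GDERIV_grad:
  fixes f :: "real^'n \<Rightarrow> real"
  assumes "f differentiable at x"
  shows "GDERIV f x :> grad f x"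
proof -
  obtain f' where f': "(f has_derivative f') (at x)" using assms by (auto simp: differentiable_def)
  then have "linear f'" by (rule has_derivative_linear)
  then have "f' = (\<lambda>h. h \<bullet> adjoint f' 1)" by (simp add: adjoint_works fun_eq_iff)
  with f' have "GDERIV f x :> adjoint f' 1" unfolding gderiv_def by metis
  then show ?thesis by (metis grad_eqI)
qed

lemma hessian_eqI:
  assumes "(grad f has_derivative (\<lambda>v. M *v v)) (at x)"
  shows "hessian f x = M"
  using frechet_derivative_at[OF assms, symmetric] by (simp add: hessian_def jacobian_def)

lemma has_derivative_grad:
  assumes "grad f differentiable at x"
  shows "(grad f has_derivative (\<lambda>v. hessian f x *v v)) (at x)"
  using assms by (simp add: jacobian_works hessian_def)

text \<open>Derivatives are local, so an identity on the open set \<open>U\<close> may be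
  differentiated twice. The gradient identity is proved on all of \<open>U\<close> first, since the
  second derivative needs it near \<open>z\<close>.\<close>

lemma hessian_diff:
  assumes g: "C2_on U g" and h: "C2_on U h" and f: "\<And>x. x \<in> U \<Longrightarrow> f x = g x - h x" and z: "z \<in> U"
  shows "hessian f z = hessian g z - hessian h z"
proof (rule hessian_eqI)
  have U: "open U" using g by (simp add: C2_on_def)
  have grad_f: "grad f x = grad g x - grad h x" if x: "x \<in> U" for x
  proof (rule grad_eqI)
    have "GDERIV (\<lambda>x. g x - h x) x :> grad g x - grad h x"
      using g h x by (intro GDERIV_diff GDERIV_grad) (auto simp: C2_on_def)
    then show "GDERIV f x :> grad g x - grad h x"
      unfolding gderiv_def
      by (rule has_derivative_transform_within_open[OF _ U x]) (simp add: f)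
  qed
  have "((\<lambda>x. grad g x - grad h x) has_derivative (\<lambda>v. hessian g z *v v - hessian h z *v v)) (at z)"
    using g h z by (intro has_derivative_diff has_derivative_grad) (auto simp: C2_on_def)
  then show "(grad f has_derivative (*v) (hessian g z - hessian h z)) (at z)"
    unfolding matrix_vector_mult_diff_rdistrib
    by (rule has_derivative_transform_within_open[OF _ U z]) (simp add: grad_f)
qed

text \<open>Restricted to a line through \<open>z\<close> in direction \<open>v\<close>, a convex
  function has nondecreasing slope, and the derivative of this slope at 0 is the Hessian form at
  \<open>v\<close>.\<close>

lemma convex_on_imp_hessian_psd:
  fixes g :: "real^'n \<Rightarrow> real"
  assumes conv: "convex_on S g" and g: "C2_on U g" and z: "z \<in> interior S" "z \<in> U"
  shows "0 \<le> v \<bullet> (hessian g z *v v)"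
proof -
  have "open (interior S \<inter> U)" using g by (auto simp: C2_on_def)
  \<comment> \<open>Inside this ball convexity comes from \<open>S\<close> and differentiability
    from \<open>U\<close>. Its preimage \<open>T\<close> under the line is an open convex set of
    parameters containing 0.\<close>
  then obtain e where e: "e > 0" "ball z e \<subseteq> interior S \<inter> U"
    by (rule openE) (use z in auto)
  define l where "l = (\<lambda>t. z + t *\<^sub>R v)"
  define T where "T = l -` ball z e"
  have l_comb: "l (a * s + b * t) = a *\<^sub>R l s + b *\<^sub>R l t" if "a + b = 1" for a b s t
  proof -
    have "a *\<^sub>R l s + b *\<^sub>R l t = (a + b) *\<^sub>R z + (a * s + b * t) *\<^sub>R v"
      by (simp add: l_def algebra_simps)
    with that show ?thesis by (simp add: l_def)
  qed
  have TS: "l t \<in> S" and TU: "l t \<in> U" if "t \<in> T" for t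
    using that e interior_subset[of S] unfolding T_def by blast+
  have T0: "0 \<in> T" using e by (simp add: T_def l_def)
  have "continuous_on UNIV l" unfolding l_def by (intro continuous_intros)
  then have oT: "open T" unfolding T_def by (intro open_vimage) auto
  have cT: "convex T"
    using convex_ball[of z e] l_comb unfolding convex_def T_def by simp
  have conv': "convex_on T (g \<circ> l)"
    using conv cT TS by (simp add: convex_on_def l_comb)
  have l': "(l has_derivative (\<lambda>h. h *\<^sub>R v)) (at t)" for t
    unfolding l_def by (auto intro!: derivative_eq_intros)
  have deriv: "((g \<circ> l) has_real_derivative v \<bullet> grad g (l t)) (at t)" if "t \<in> T" for t
  proof -
    have "(g has_derivative (\<lambda>h. h \<bullet> grad g (l t))) (at (l t))"
      using GDERIV_grad g TU[OF that] by (auto simp: C2_on_def gderiv_def)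
    from diff_chain_at[OF l' this] show ?thesis
      by (simp add: has_field_derivative_def o_def mult.commute[of _ "v \<bullet> _"])
  qed
  have tangent: "(g \<circ> l) s - (g \<circ> l) t \<ge> (v \<bullet> grad g (l t)) * (s - t)" if "s \<in> T" "t \<in> T" for s t
    using that oT cT deriv
    by (intro convex_on_imp_above_tangent[OF conv'])
       (auto simp: convex_connected interior_open intro: has_field_derivative_at_within)
  \<comment> \<open>Adding the tangent inequalities at \<open>s\<close> and at \<open>t\<close>
    cancels the function values and leaves the monotonicity of the slope.\<close>
  have "mono_on T (\<lambda>t. v \<bullet> grad g (l t))"
  proof (rule mono_onI)
    fix s t assume st: "s \<in> T" "t \<in> T" "s \<le> t"
    have "0 \<le> (v \<bullet> grad g (l t) - v \<bullet> grad g (l s)) * (t - s)"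
      using tangent[OF st(1,2)] tangent[OF st(2,1)] by (simp add: algebra_simps)
    then show "v \<bullet> grad g (l s) \<le> v \<bullet> grad g (l t)"
      using st(3) by (cases "s = t") (auto simp: zero_le_mult_iff)
  qed
  moreover have "((\<lambda>t. v \<bullet> grad g (l t)) has_real_derivative v \<bullet> (hessian g z *v v)) (at 0)"
  proof -
    have "l 0 = z" by (simp add: l_def)
    then have "(grad g has_derivative (\<lambda>w. hessian g z *v w)) (at (l 0))"
      using has_derivative_grad g z by (auto simp: C2_on_def)
    from diff_chain_at[OF l' this]
    have "((\<lambda>t. grad g (l t)) has_derivative (\<lambda>h. h *\<^sub>R (hessian g z *v v))) (at 0)"
      by (simp add: o_def matrix_vector_mult_scaleR)
    from has_derivative_inner_right[OF this, of v] show ?thesis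
      by (simp add: has_field_derivative_def mult.commute[of _ "v \<bullet> _"])
  qed
  ultimately show ?thesis
    using T0 oT by (auto intro: mono_on_imp_deriv_nonneg simp: interior_open)
qed

section \<open>Derivatives and convexity of quadratic functions\<close>

lemma GDERIV_quadratic:
  fixes M :: "real^'n^'n"
  assumes "transpose M = M"
  shows "GDERIV (\<lambda>x. 1/2 * (x \<bullet> (M *v x)) + a \<bullet> x + b) x :> M *v x + a"
proof -
  have M: "((\<lambda>x. M *v x) has_derivative (\<lambda>v. M *v v)) (at x)"
    by (simp add: bounded_linear_imp_has_derivative)
  have "((\<lambda>x. 1/2 * (x \<bullet> (M *v x)) + a \<bullet> x + b) has_derivative
      (\<lambda>h. 1/2 * (x \<bullet> (M *v h) + h \<bullet> (M *v x)) + a \<bullet> h)) (at x)"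
    by (auto intro!: derivative_eq_intros M)
  \<comment> \<open>Symmetry of \<open>M\<close> makes the two product-rule terms equal, which
    absorbs the factor 1/2.\<close>
  moreover have "1/2 * (x \<bullet> (M *v h) + h \<bullet> (M *v x)) + a \<bullet> h = h \<bullet> (M *v x + a)" for h
    using dot_matrix_vector_symmetric[OF assms, of x h]
    by (simp add: inner_add_right inner_commute[of a h] inner_commute[of "M *v x" h])
  ultimately show ?thesis unfolding gderiv_def by (simp only:)
qed

text \<open>The linear and constant terms are included so that the same facts serve
  \<open>f\<close>, \<open>g\<close> and \<open>h\<close>.\<close>

lemma
  fixes M :: "real^'n^'n"
  assumes "transpose M = M"
  shows hessian_quadratic: "hessian (\<lambda>x. 1/2 * (x \<bullet> (M *v x)) + a \<bullet> x + b) = (\<lambda>x. M)"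
    and C2_on_quadratic: "open U \<Longrightarrow> C2_on U (\<lambda>x. 1/2 * (x \<bullet> (M *v x)) + a \<bullet> x + b)"
proof -
  let ?q = "\<lambda>x. 1/2 * (x \<bullet> (M *v x)) + a \<bullet> x + b"
  have grad: "grad ?q = (\<lambda>x. M *v x + a)"
    using GDERIV_quadratic[OF assms] by (blast intro: grad_eqI)
  have M: "((\<lambda>x. M *v x) has_derivative (\<lambda>v. M *v v)) (at x)" for x
    by (simp add: bounded_linear_imp_has_derivative)
  have grad': "(grad ?q has_derivative (\<lambda>v. M *v v)) (at x)" for x
    unfolding grad by (auto intro!: derivative_eq_intros M)
  show hess: "hessian ?q = (\<lambda>x. M)"
    using grad' by (blast intro: hessian_eqI)
  show "C2_on U ?q" if "open U"
    using that grad' GDERIV_quadratic[OF assms, unfolded gderiv_def] unfolding C2_on_def hess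
      differentiable_def by (intro conjI ballI) (blast intro: continuous_on_const)+
qed

text \<open>The affine part cancels from the convexity defect, leaving
  \<open>t * (1 - t) / 2\<close> times the quadratic form at \<open>x - y\<close>.\<close>

lemma convex_on_quadratic:
  fixes M :: "real^'n^'n"
  assumes M: "transpose M = M" and psd: "\<And>v. 0 \<le> v \<bullet> (M *v v)" and S: "convex S"
  shows "convex_on S (\<lambda>x. 1/2 * (x \<bullet> (M *v x)) + a \<bullet> x + b)"
proof (rule convex_onI[OF _ S])
  fix t :: real and x y :: "real^'n" assume t: "0 < t" "t < 1"
  let ?q = "\<lambda>x. 1/2 * (x \<bullet> (M *v x)) + a \<bullet> x + b"
  have yx: "y \<bullet> (M *v x) = x \<bullet> (M *v y)"
    by (simp add: dot_matrix_vector_symmetric[OF M, of x] inner_commute)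
  have "(1 - t) * ?q x + t * ?q y - ?q ((1 - t) *\<^sub>R x + t *\<^sub>R y)
      = t * (1 - t) / 2 * ((x - y) \<bullet> (M *v (x - y)))"
    unfolding matrix_vector_right_distrib matrix_vector_mult_diff_distrib matrix_vector_mult_scaleR
      inner_add_left inner_add_right inner_diff_left inner_diff_right inner_scaleR_left
      inner_scaleR_right yx
    by (simp add: field_simps)
  also have "\<dots> \<ge> 0" using t psd by simp
  finally show "?q ((1 - t) *\<^sub>R x + t *\<^sub>R y) \<le> (1 - t) * ?q x + t * ?q y" by simp
qed

section \<open>The minimal dimension\<close>

theorem theorem9p2:
  fixes X :: "(real^'n) set" and Q :: "real^'n^'n" and c :: "real^'n" and \<beta> :: real
    and f :: "real^'n \<Rightarrow> real"
  assumes "compact X"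
    and "affine hull X = UNIV"
    and "transpose Q = Q"
    and "f = (\<lambda>x. 1/2 * (x \<bullet> (Q *v x)) + c \<bullet> x + \<beta>)"
  shows "d_star f X = n_plus Q
    \<and> (\<exists>Qp Qm. pos_neg_decomp Q Qp Qm)
    \<and> (\<forall>Qp Qm g h. pos_neg_decomp Q Qp Qm
         \<longrightarrow> g = (\<lambda>x. 1/2 * (x \<bullet> (Qp *v x)))
         \<longrightarrow> h = (\<lambda>x. 1/2 * (x \<bullet> (Qm *v x)) - c \<bullet> x - \<beta>)
         \<longrightarrow> (g, h) \<in> D2 f X \<and> d_X X g = d_star f X)"
proof -
  let ?C = "convex hull X"
  \<comment> \<open>A nonempty convex set has nonempty relative interior, which is the interior here
    because the affine hull is the whole space.\<close>
  have "?C \<noteq> {}" using assms(2) by auto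
  moreover have "affine hull ?C = UNIV" using assms(2) by simp
  ultimately have "interior ?C \<noteq> {}"
    by (metis convex_convex_hull rel_interior_eq_empty rel_interior_interior)
  then obtain z where z: "z \<in> interior ?C" by blast
  then have zC: "z \<in> ?C" using interior_subset by blast
  obtain P0 d0 where "orthogonal_matrix P0" and Q0: "Q = P0 ** diag_matrix d0 ** transpose P0"
    using symmetric_orthogonal_diagonalization[OF assms(3)] by blast
  then interpret D0: orthogonal_diagonalization P0 d0 by unfold_locales
  have ex: "\<exists>Qp Qm. pos_neg_decomp Q Qp Qm"
    unfolding pos_neg_decomp_def using D0.orthogonal Q0 by blast
  have lower: "n_plus Q \<le> d_X X g" if "(g, h) \<in> D2 f X" for g h
  proof -
    obtain U where U: "?C \<subseteq> U" "C2_on U g" "C2_on U h" "\<And>x. x \<in> U \<Longrightarrow> f x = g x - h x"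
      and conv: "convex_on ?C g" "convex_on ?C h"
      using \<open>(g, h) \<in> D2 f X\<close> unfolding D2_def by blast
    have zU: "z \<in> U" using zC U(1) by blast
    have "Q = hessian f z" unfolding assms(4) hessian_quadratic[OF assms(3)] ..
    also have "\<dots> = hessian g z - hessian h z" by (rule hessian_diff[OF U(2-4) zU])
    finally have Q: "Q = hessian g z - hessian h z" .
    \<comment> \<open>The difference of the two sides is the form of \<open>hessian h z\<close>,
      which is nonnegative by convexity of \<open>h\<close>.\<close>
    have "v \<bullet> (D0.A *v v) \<le> v \<bullet> (hessian g z *v v)" for v
      using convex_on_imp_hessian_psd[OF conv(2) U(3) z zU, of v]
      unfolding D0.A_def Q0[symmetric] Q by (simp add: matrix_vector_mult_diff_rdistrib inner_diff_right)
    from D0.card_positive_le_dim_range[OF this]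
    have "n_plus Q \<le> dim (range ((*v) (hessian g z)))"
      by (simp add: Q0 n_plus_orthogonal_diagonalization[OF D0.orthogonal])
    \<comment> \<open>The range at the single point \<open>z\<close> is already one of the sets
      whose union spans \<open>V_X X g\<close>.\<close>
    also have "\<dots> \<le> d_X X g"
      unfolding d_X_def V_X_def dim_span using zC by (intro dim_subset) blast
    finally show ?thesis .
  qed
  have attained: "(g, h) \<in> D2 f X \<and> d_X X g = n_plus Q"
    if decomp: "pos_neg_decomp Q Qp Qm" and g: "g = (\<lambda>x. 1/2 * (x \<bullet> (Qp *v x)))"
      and h: "h = (\<lambda>x. 1/2 * (x \<bullet> (Qm *v x)) - c \<bullet> x - \<beta>)" for Qp Qm g h
  proof -
    obtain P d where P: "orthogonal_matrix P" and Q: "Q = P ** diag_matrix d ** transpose P"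
      and Qp: "Qp = P ** diag_matrix (\<lambda>i. max (d i) 0) ** transpose P"
      and Qm: "Qm = P ** diag_matrix (\<lambda>i. max (- d i) 0) ** transpose P"
      using decomp unfolding pos_neg_decomp_def by blast
    interpret D: orthogonal_diagonalization P d by unfold_locales (rule P)
    interpret Dp: orthogonal_diagonalization P "\<lambda>i. max (d i) 0" by unfold_locales (rule P)
    interpret Dm: orthogonal_diagonalization P "\<lambda>i. max (- d i) 0" by unfold_locales (rule P)
    have A: "D.A = Q" "Dp.A = Qp" "Dm.A = Qm"
      by (simp_all add: D.A_def Dp.A_def Dm.A_def Q Qp Qm)
    have psd: "0 \<le> v \<bullet> (Qp *v v)" "0 \<le> v \<bullet> (Qm *v v)" for v
      using Dp.inner_mult_vec[of v] Dm.inner_mult_vec[of v] by (simp_all add: A sum_nonneg)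
    have sym: "transpose Qp = Qp" "transpose Qm = Qm"
      using Dp.transpose_eq Dm.transpose_eq by (simp_all add: A)
    \<comment> \<open>Both functions are brought into the shape of the lemmas on quadratic
      functions.\<close>
    have g': "g = (\<lambda>x. 1/2 * (x \<bullet> (Qp *v x)) + 0 \<bullet> x + 0)" by (simp add: g)
    have h': "h = (\<lambda>x. 1/2 * (x \<bullet> (Qm *v x)) + (- c) \<bullet> x + (- \<beta>))" by (simp add: h)
    \<comment> \<open>With common eigenvectors this reduces to
      \<open>max a 0 - max (- a) 0 = a\<close> for each eigenvalue.\<close>
    have Q_split: "Q *v x = Qp *v x - Qm *v x" for x
      unfolding A[symmetric] D.mult_vec_eq_sum Dp.mult_vec_eq_sum Dm.mult_vec_eq_sum
        sum_subtractf[symmetric] scaleR_diff_left[symmetric] left_diff_distrib[symmetric]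
      by (intro sum.cong) (auto simp: max_def)
    have "f x = g x - h x" for x
      by (simp add: assms(4) g h Q_split inner_diff_right diff_divide_distrib)
    moreover have "C2_on UNIV g" "C2_on UNIV h"
      unfolding g' h' by (rule C2_on_quadratic[OF _ open_UNIV], rule sym)+
    moreover have "convex_on ?C g" "convex_on ?C h"
      unfolding g' h' by (rule convex_on_quadratic[OF _ _ convex_convex_hull], rule sym, rule psd)+
    ultimately have "(g, h) \<in> D2 f X" unfolding D2_def by blast
    moreover have "d_X X g = n_plus Q"
    proof -
      have "hessian g = (\<lambda>x. Qp)" unfolding g' by (rule hessian_quadratic[OF sym(1)])
      \<comment> \<open>The Hessian is constant and the hull contains \<open>z\<close>, so the union
        over the hull is one single range.\<close>
      then have "d_X X g = dim (range ((*v) Dp.A))"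
        using zC by (auto simp: d_X_def V_X_def A)
      also have "\<dots> = card {i. max (d i) 0 \<noteq> 0}" by (rule Dp.dim_range_mult_vec)
      also have "{i. max (d i) 0 \<noteq> 0} = {i. d i > 0}" by (auto simp: max_def)
      finally show ?thesis by (simp add: Q n_plus_orthogonal_diagonalization[OF P])
    qed
    ultimately show ?thesis by blast
  qed
  obtain Qp Qm where "pos_neg_decomp Q Qp Qm" using ex by blast
  from attained[OF this refl refl] obtain g h where gh: "(g, h) \<in> D2 f X" "d_X X g = n_plus Q"
    by blast
  have "d_star f X = n_plus Q"
  proof (rule antisym)
    show "d_star f X \<le> n_plus Q"
      unfolding d_star_def using cINF_lower[OF bdd_below_bot gh(1), of "\<lambda>(g, h). d_X X g"] gh(2) by simp
    \<comment> \<open>Here \<open>gh\<close> supplies the nonemptiness that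
      \<open>cINF_greatest\<close> asks for.\<close>
    show "n_plus Q \<le> d_star f X"
      unfolding d_star_def using gh(1) lower by (intro cINF_greatest) auto
  qed
  then show ?thesis using ex attained by (intro conjI allI impI) (auto simp only:)
qed

end
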